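(* Let $n\ge 1$ be an integer, let $m,d,k_1>0$, and let $\boldsymbol L\in\mathbb{R}^{n\times n}$ be the (symmetric) Laplacian matrix of an undirected weighted graph on $n$ nodes with positive edge weights. Consider the closed-loop system of GBPIAC with input matrix $\boldsymbol B=\boldsymbol I_n$, \begin{align*} \dot{\boldsymbol\theta}&=\boldsymbol\omega,\\ m\,\dot{\boldsymbol\omega}&=-\boldsymbol L\boldsymbol\theta-d\,\boldsymbol\omega+\frac{4k_1\xi_s}{n}\boldsymbol 1_n+\boldsymbol w,\\ \dot\eta_s&=d\,\boldsymbol 1_n^T\boldsymbol\omega,\\ \dot\xi_s&=-k_1m\,\boldsymbol 1_n^T\boldsymbol\omega-k_1\eta_s-4k_1\xi_s, \end{align*} with state $(\boldsymbol\theta,\boldsymbol\omega,\eta_s,\xi_s)\in\mathbb{R}^n\times\mathbb{R}^n\times\mathbb{R}\times\mathbb{R}$, input $\boldsymbol w\in\mathbb{R}^n$, and control input $\boldsymbol u=\frac{4k_1\xi_s}{n}\boldsymbol 1_n$. Let $\|\boldsymbol G_c(\boldsymbol\omega,\boldsymbol w)\|_2^2$ and $\|\boldsymbol G_c(\boldsymbol u,\boldsymbol w)\|_2^2$ be the squared $\mathcal{H}_2$ norms of this system from the input $\boldsymbol w$ to the outputs $\boldsymbol y=\boldsymbol\omega$ and $\boldsymbol y=\boldsymbol u$, respectively. Then \begin{align*} \|\boldsymbol G_c(\boldsymbol\omega,\boldsymbol w)\|_2^2&=\frac{n-1}{2md}+\frac{d+5mk_1}{2m(2k_1m+d)^2},\\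 \|\boldsymbol G_c(\boldsymbol u,\boldsymbol w)\|_2^2&=\frac{k_1}{2}. \end{align*}
   Context: $\boldsymbol 1_n\in\mathbb{R}^n$ is the all-ones vector and $\boldsymbol I_n$ the identity matrix. GBPIAC (Gather-Broadcast Power-Imbalance Allocation Control) is a centralized secondary frequency control law for power systems; the system in the claim is the linearized power system with homogeneous parameters (inertia $m$, damping $d$, control prices $1$), closed by this law with gains $k_1$ and $k_2=4k_1$. Here $\boldsymbol\theta$ are phase angles, $\boldsymbol\omega$ frequency deviations, and $\eta_s,\xi_s$ controller states. $\mathcal{H}_2$ norm: for a linear time-invariant system $\dot{\boldsymbol x}=\boldsymbol A\boldsymbol x+\tilde{\boldsymbol B}\boldsymbol w$, $\boldsymbol y=\boldsymbol C\boldsymbol x$, the squared $\mathcal{H}_2$ norm of the transfer matrix from $\boldsymbol w$ to $\boldsymbol y$ is $$\int_0^\infty \mathrm{tr}\big(\tilde{\boldsymbol B}^Te^{\boldsymbol A^Tt}\boldsymbol C^T\boldsymbol C e^{\boldsymbol At}\tilde{\boldsymbol B}\big)\,dt .$$ When $\boldsymbol A$ is Hurwitz this equals $\mathrm{tr}(\tilde{\boldsymbol B}^T\boldsymbol Q_o\tilde{\boldsymbol B})$, where $\boldsymbol Q_o$ solves $\boldsymbol Q_o\boldsymbol A+\boldsymbol A^T\boldsymbol Q_o+\boldsymbol C^T\boldsymbol C=\boldsymbol 0$. The system is put in this form by taking $\boldsymbol x=(\boldsymbol\theta,\boldsymbol\omega,\eta_s,\xi_s)$ and dividing the second equation by $m$.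 *)

theory Defs
  imports "HOL-Analysis.Analysis"
begin

text \<open>
  An undirected weighted graph on the vertex set \<^term>\<open>UNIV :: 'n set\<close> is given by its set of
  edges (two-element sets, so no self-loops) and a weight for each edge. It need not be connected.
\<close>

definition weighted_graph :: "'n set set \<Rightarrow> ('n set \<Rightarrow> real) \<Rightarrow> bool" where
  "weighted_graph E a \<longleftrightarrow> (\<forall>e\<in>E. card e = 2 \<and> a e > 0)"

definition laplacian :: "'n::finite set set \<Rightarrow> ('n set \<Rightarrow> real) \<Rightarrow> real^'n^'n" where
  "laplacian E a = (\<chi> i j.
     if i = j then (\<Sum>k | {i, k} \<in> E. a {i, k})
     else if {i, j} \<in> E then - a {i, j}
     else 0)"

text \<open>
  The constants \<^const>\<open>power\<close> and \<^const>\<open>exp\<close> do not serve here: multiplication on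
  \<^typ>\<open>real^'n^'n\<close> is the entrywise one, the matrix product being \<^term>\<open>(**)\<close>.
\<close>

definition mat_pow :: "real^'s::finite^'s \<Rightarrow> nat \<Rightarrow> real^'s^'s" where
  "mat_pow A k = (((**) A) ^^ k) (mat 1)"

definition mat_exp :: "real^'s::finite^'s \<Rightarrow> real^'s^'s" where
  "mat_exp A = (\<Sum>k. (1 / fact k) *\<^sub>R mat_pow A k)"

text \<open>
  Squared H2 norm from \<open>w\<close> to \<open>y\<close> of the system \<open>x' = A x + B w\<close>, \<open>y = C x\<close>. The integrand is
  a squared Frobenius norm, hence nonnegative, and the value \<open>\<infinity>\<close> is taken when the integral
  diverges.
\<close>

definition H2_norm_sq :: "real^'s::finite^'s \<Rightarrow> real^'w::finite^'s \<Rightarrow> real^'s^'y::finite \<Rightarrow> ennreal" where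
  "H2_norm_sq A B C =
     (\<integral>\<^sup>+ t \<in> {0..}. ennreal (trace
        (transpose B ** mat_exp (t *\<^sub>R transpose A) ** transpose C ** C ** mat_exp (t *\<^sub>R A) ** B))
      \<partial>lborel)"

datatype 'n state_idx = Theta 'n | Omega 'n | Eta | Xi

instance state_idx :: (finite) finite
proof
  have "x \<in> range Theta \<union> range Omega \<union> {Eta, Xi}" for x :: "'a state_idx"
    by (cases x) simp_all
  then have "(UNIV :: 'a state_idx set) \<subseteq> range Theta \<union> range Omega \<union> {Eta, Xi}"
    by (rule subsetI)
  then show "finite (UNIV :: 'a state_idx set)"
    by (rule finite_subset) simp
qed

type_synonym 'n state = "real ^ 'n state_idx"

definition theta :: "'n::finite state \<Rightarrow> real^'n" where
  "theta x = (\<chi> i. x $ Theta i)"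

definition omega :: "'n::finite state \<Rightarrow> real^'n" where
  "omega x = (\<chi> i. x $ Omega i)"

definition mk_state :: "real^'n::finite \<Rightarrow> real^'n \<Rightarrow> real \<Rightarrow> real \<Rightarrow> 'n state" where
  "mk_state p q r s = (\<chi> i. case i of Theta j \<Rightarrow> p $ j | Omega j \<Rightarrow> q $ j | Eta \<Rightarrow> r | Xi \<Rightarrow> s)"

definition control :: "real \<Rightarrow> 'n::finite state \<Rightarrow> real^'n" where
  "control k1 x = (4 * k1 * x $ Xi / real CARD('n)) *\<^sub>R 1"

text \<open>
  Right-hand side of the closed loop, with the swing equation divided by \<open>m\<close>; \<^term>\<open>1 :: real^'n\<close>
  is the all-ones vector.
\<close>

definition gbpiac_rhs ::
  "real \<Rightarrow> real \<Rightarrow> real \<Rightarrow> real^'n::finite^'n \<Rightarrow> 'n state \<Rightarrow> real^'n \<Rightarrow> 'n state" where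
  "gbpiac_rhs m d k1 L x w = mk_state
     (omega x)
     ((1 / m) *\<^sub>R (- (L *v theta x) - d *\<^sub>R omega x + control k1 x + w))
     (d * (1 \<bullet> omega x))
     (- k1 * m * (1 \<bullet> omega x) - k1 * x $ Eta - 4 * k1 * x $ Xi)"

definition gbpiac_A :: "real \<Rightarrow> real \<Rightarrow> real \<Rightarrow> real^'n::finite^'n \<Rightarrow> real^'n state_idx^'n state_idx" where
  "gbpiac_A m d k1 L = matrix (\<lambda>x. gbpiac_rhs m d k1 L x 0)"

definition gbpiac_B :: "real \<Rightarrow> real \<Rightarrow> real \<Rightarrow> real^'n::finite^'n \<Rightarrow> real^'n^'n state_idx" where
  "gbpiac_B m d k1 L = matrix (\<lambda>w. gbpiac_rhs m d k1 L 0 w)"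

definition C_omega :: "real^'n::finite state_idx^'n" where
  "C_omega = matrix omega"

definition C_u :: "real \<Rightarrow> real^'n::finite state_idx^'n" where
  "C_u k1 = matrix (control k1)"

lemma linear_omega: "linear (omega :: 'n::finite state \<Rightarrow> _)"
  by (rule linearI) (simp_all add: omega_def vec_eq_iff)

lemma linear_theta: "linear (theta :: 'n::finite state \<Rightarrow> _)"
  by (rule linearI) (simp_all add: theta_def vec_eq_iff)

lemma linear_control: "linear (control k1 :: 'n::finite state \<Rightarrow> _)"
  by (rule linearI) (simp_all add: control_def vec_eq_iff field_simps)

lemma C_omega_works: "C_omega *v x = omega x"
  unfolding C_omega_def using matrix_vector_mul(2)[OF linear_omega] by metis

lemma C_u_works: "C_u k1 *v x = control k1 x"
  unfolding C_u_def using matrix_vector_mul(2)[OF linear_control] by metis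

lemma gbpiac_rhs_nth:
  "gbpiac_rhs m d k1 L x w $ i = (case i of
     Theta j \<Rightarrow> omega x $ j
   | Omega j \<Rightarrow> (1 / m) * (- (L *v theta x) $ j - d * omega x $ j + control k1 x $ j + w $ j)
   | Eta \<Rightarrow> d * (1 \<bullet> omega x)
   | Xi \<Rightarrow> - k1 * m * (1 \<bullet> omega x) - k1 * x $ Eta - 4 * k1 * x $ Xi)"
  by (simp add: gbpiac_rhs_def mk_state_def split: state_idx.split)

lemma gbpiac_rhs_add:
  "gbpiac_rhs m d k1 L (x + y) (v + w) = gbpiac_rhs m d k1 L x v + gbpiac_rhs m d k1 L y w"
  unfolding vec_eq_iff vector_add_component gbpiac_rhs_nth
    linear_add[OF linear_omega] linear_add[OF linear_theta] linear_add[OF linear_control]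
    matrix_vector_right_distrib inner_add_right
  by (simp add: algebra_simps split: state_idx.split)

lemma gbpiac_rhs_scaleR:
  "gbpiac_rhs m d k1 L (c *\<^sub>R x) (c *\<^sub>R w) = c *\<^sub>R gbpiac_rhs m d k1 L x w"
  unfolding vec_eq_iff vector_scaleR_component gbpiac_rhs_nth
    linear_scale[OF linear_omega] linear_scale[OF linear_theta] linear_scale[OF linear_control]
    matrix_vector_mult_scaleR inner_scaleR_right
  by (simp add: algebra_simps split: state_idx.split)

lemma gbpiac_rhs_eq:
  "gbpiac_rhs m d k1 L x w = gbpiac_A m d k1 L *v x + gbpiac_B m d k1 L *v w"
proof -
  have A: "linear (\<lambda>x. gbpiac_rhs m d k1 L x 0)"
    by (rule linearI)
      (metis gbpiac_rhs_add add_0_right, metis gbpiac_rhs_scaleR scaleR_zero_right)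
  have B: "linear (\<lambda>w. gbpiac_rhs m d k1 L 0 w)"
    by (rule linearI)
      (metis gbpiac_rhs_add add_0_right, metis gbpiac_rhs_scaleR scaleR_zero_right)
  have "gbpiac_rhs m d k1 L x w = gbpiac_rhs m d k1 L x 0 + gbpiac_rhs m d k1 L 0 w"
    using gbpiac_rhs_add[of m d k1 L x 0 0 w] by simp
  then show ?thesis
    using fun_cong[OF matrix_vector_mul(2)[OF A]] fun_cong[OF matrix_vector_mul(2)[OF B]]
    by (simp add: gbpiac_A_def gbpiac_B_def)
qed

end

theory Submission
  imports Defs
begin

text \<open>
  The matrix \<open>A\<close> is singular (and the graph may be disconnected), so the Lyapunov equation cannot be
  invoked directly. Instead a function \<open>V\<close> is exhibited that decreases along trajectories at rate
  \<open>|y|\<^sup>2\<close> and tends to \<open>0\<close> along each of them; the squared H2 norm is then the sum of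
  \<open>V\<close> over the columns of \<open>B\<close>. Since \<open>L 1 = 0\<close>, the dynamics splits into two parts. The
  deviations of \<open>\<theta>\<close> and \<open>\<omega>\<close> from their means form a damped oscillator whose mechanical energy
  dissipates at rate \<open>d\<close> times the squared norm of the deviation of \<open>\<omega>\<close>. With \<open>s = 1 \<bullet> \<omega>\<close>
  and \<open>\<zeta> = m s + \<eta>\<close>, the mean obeys \<open>m s' = 4 k\<^sub>1 \<xi> - d s\<close>,
  \<open>\<zeta>' = 4 k\<^sub>1 \<xi>\<close>, \<open>\<xi>' = - k\<^sub>1 \<zeta> - 4 k\<^sub>1 \<xi>\<close>, a stable system that is
  independent of the graph.
\<close>

section \<open>The matrix exponential\<close>

lemma mat_pow_0: "mat_pow A 0 = mat 1"
  by (simp add: mat_pow_def)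

lemma mat_pow_Suc: "mat_pow A (Suc k) = A ** mat_pow A k"
  by (simp add: mat_pow_def)

lemma mat_pow_commute: "mat_pow A k ** A = A ** mat_pow A k"
  by (induction k) (simp_all add: mat_pow_0 mat_pow_Suc flip: matrix_mul_assoc)

lemma mat_pow_scaleR: "mat_pow (t *\<^sub>R A) k = t ^ k *\<^sub>R mat_pow A k"
  by (induction k)
    (simp_all add: mat_pow_0 mat_pow_Suc matrix_scalar_ac mult.commute flip: scalar_matrix_assoc)

lemma mat_pow_transpose: "mat_pow (transpose A) k = transpose (mat_pow A k)"
proof (induction k)
  case (Suc k)
  have "mat_pow (transpose A) (Suc k) = transpose (mat_pow A k ** A)"
    by (simp only: mat_pow_Suc Suc.IH matrix_transpose_mul)
  then show ?case
    by (simp only: mat_pow_commute mat_pow_Suc)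
qed (simp add: mat_pow_0 transpose_mat)

text \<open>The sum of all absolute entries dominates every row sum, so each further factor
  \<open>A\<close> costs at most one factor of it.\<close>

lemma mat_pow_entry_bound:
  "\<bar>mat_pow A k $ i $ j\<bar> \<le> (\<Sum>p\<in>UNIV. \<Sum>q\<in>UNIV. \<bar>A $ p $ q\<bar>) ^ k"
proof (induction k arbitrary: i)
  case 0
  then show ?case by (simp add: mat_pow_0 mat_def)
next
  case (Suc k)
  let ?M = "\<Sum>p\<in>UNIV. \<Sum>q\<in>UNIV. \<bar>A $ p $ q\<bar>"
  have M: "0 \<le> ?M" by (simp add: sum_nonneg)
  have "\<bar>mat_pow A (Suc k) $ i $ j\<bar> \<le> (\<Sum>q\<in>UNIV. \<bar>A $ i $ q\<bar> * \<bar>mat_pow A k $ q $ j\<bar>)"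
    by (simp add: mat_pow_Suc matrix_matrix_mult_def flip: abs_mult)
  also have "\<dots> \<le> (\<Sum>q\<in>UNIV. \<bar>A $ i $ q\<bar> * ?M ^ k)"
    by (intro sum_mono mult_left_mono Suc.IH) simp
  also have "\<dots> = (\<Sum>q\<in>UNIV. \<bar>A $ i $ q\<bar>) * ?M ^ k"
    by (simp add: sum_distrib_right)
  also have "\<dots> \<le> ?M * ?M ^ k"
    by (intro mult_right_mono member_le_sum) (simp_all add: sum_nonneg M)
  finally show ?case by simp
qed

text \<open>Each entry is written as a real power series in \<open>t\<close>, so that termwise
  differentiation applies later; the bound on the entries of the powers gives an exponential series
  as majorant.\<close>

lemma summable_mat_pow: "summable (\<lambda>k. mat_pow A k $ i $ j / fact k * t ^ k)"
proof (rule summable_comparison_test')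
  let ?M = "\<Sum>p\<in>UNIV. \<Sum>q\<in>UNIV. \<bar>A $ p $ q\<bar>"
  show "summable (\<lambda>k. inverse (fact k) * (?M * \<bar>t\<bar>) ^ k)"
    by (rule summable_exp)
  show "norm (mat_pow A k $ i $ j / fact k * t ^ k) \<le> inverse (fact k) * (?M * \<bar>t\<bar>) ^ k" for k
    using mult_right_mono[OF mat_pow_entry_bound[of A k i j], of "\<bar>t\<bar> ^ k / fact k"]
    by (simp add: abs_mult power_abs power_mult_distrib field_simps)
qed

lemma mat_exp_scaleR_entry:
  "mat_exp (t *\<^sub>R A) $ i $ j = (\<Sum>k. mat_pow A k $ i $ j / fact k * t ^ k)"
proof -
  have "(\<lambda>k. (1 / fact k) *\<^sub>R mat_pow (t *\<^sub>R A) k)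
      sums (\<chi> i j. \<Sum>k. mat_pow A k $ i $ j / fact k * t ^ k)"
    unfolding sums_def
    by (intro vec_tendstoI)
      (use summable_LIMSEQ[OF summable_mat_pow[of A]] in \<open>simp add: mat_pow_scaleR mult.commute\<close>)
  then show ?thesis
    by (simp add: mat_exp_def sums_iff)
qed

lemma mat_exp_transpose: "mat_exp (t *\<^sub>R transpose A) = transpose (mat_exp (t *\<^sub>R A))"
proof -
  have "mat_exp (t *\<^sub>R transpose A) $ i $ j = transpose (mat_exp (t *\<^sub>R A)) $ i $ j" for i j
    unfolding mat_exp_scaleR_entry mat_pow_transpose
    by (simp only: transpose_def vec_lambda_beta mat_exp_scaleR_entry)
  then show ?thesis by (intro iffD2[OF vec_eq_iff] allI)
qed

lemma mat_exp_0: "mat_exp (0 *\<^sub>R A) = mat 1"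
  unfolding vec_eq_iff mat_exp_scaleR_entry
  using powser_zero[of "\<lambda>k. mat_pow A k $ i $ j / fact k" for i j]
  by (simp add: mat_pow_0)

text \<open>Termwise differentiation shifts the index by one and turns
  \<open>1 / fact (Suc k)\<close> into \<open>1 / fact k\<close>; splitting off one factor
  \<open>A\<close> from \<open>mat_pow A (Suc k)\<close> leaves a finite combination of entries of
  the exponential.\<close>

lemma has_real_derivative_mat_exp_entry:
  "((\<lambda>t. mat_exp (t *\<^sub>R A) $ i $ j) has_real_derivative (A ** mat_exp (t *\<^sub>R A)) $ i $ j) (at t)"
proof -
  let ?c = "\<lambda>i k. mat_pow A k $ i $ j / fact k"
  have diffs: "diffs (?c i) k * t ^ k = (\<Sum>q\<in>UNIV. A $ i $ q * (?c q k * t ^ k))" for k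
  proof -
    have "diffs (?c i) k = (\<Sum>q\<in>UNIV. A $ i $ q * mat_pow A k $ q $ j) / fact k"
      using fact_Suc[of k, where 'a = real]
      by (simp add: diffs_def mat_pow_Suc matrix_matrix_mult_def del: of_nat_Suc)
    then show ?thesis
      by (simp add: sum_distrib_right sum_divide_distrib mult.assoc)
  qed
  have "(\<Sum>k. diffs (?c i) k * t ^ k) = (\<Sum>q\<in>UNIV. \<Sum>k. A $ i $ q * (?c q k * t ^ k))"
    unfolding diffs by (intro suminf_sum summable_mult summable_mat_pow)
  also have "\<dots> = (A ** mat_exp (t *\<^sub>R A)) $ i $ j"
    by (simp only: suminf_mult[OF summable_mat_pow] matrix_matrix_mult_def mat_exp_scaleR_entry
        vec_lambda_beta)
  finally show ?thesis
    using termdiffs_strong_converges_everywhere[OF summable_mat_pow[of A i j], of t]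
    by (simp add: mat_exp_scaleR_entry)
qed

lemma has_vector_derivative_vec:
  fixes x :: "real \<Rightarrow> real^'n"
  assumes "\<And>i. ((\<lambda>t. x t $ i) has_real_derivative y $ i) (at t)"
  shows "(x has_vector_derivative y) (at t)"
  unfolding has_vector_derivative_def
proof (rule iffD2[OF has_derivative_componentwise_within], rule ballI)
  fix b :: "real^'n" assume "b \<in> Basis"
  then obtain i where b: "b = axis i 1"
    by (auto simp: Basis_vec_def)
  have "(\<lambda>h. (h *\<^sub>R y) \<bullet> b) = (*) (y $ i)"
    by (rule ext) (simp add: b inner_axis)
  then show "((\<lambda>t. x t \<bullet> b) has_derivative (\<lambda>h. (h *\<^sub>R y) \<bullet> b)) (at t)"
    using assms[of i] by (simp add: b inner_axis has_field_derivative_def)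
qed

lemma has_vector_derivative_mat_exp:
  "((\<lambda>t. mat_exp (t *\<^sub>R A) *v v) has_vector_derivative A *v (mat_exp (t *\<^sub>R A) *v v)) (at t)"
proof (rule has_vector_derivative_vec)
  fix i
  have "((\<lambda>t. \<Sum>j\<in>UNIV. mat_exp (t *\<^sub>R A) $ i $ j * v $ j) has_real_derivative
      (\<Sum>j\<in>UNIV. (A ** mat_exp (t *\<^sub>R A)) $ i $ j * v $ j)) (at t)"
    by (intro DERIV_sum DERIV_cmult_right has_real_derivative_mat_exp_entry)
  then show "((\<lambda>t. (mat_exp (t *\<^sub>R A) *v v) $ i) has_real_derivative
      (A *v (mat_exp (t *\<^sub>R A) *v v)) $ i) (at t)"
    unfolding matrix_vector_mul_assoc by (simp add: matrix_vector_mult_def)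
qed

section \<open>Computing the H2 norm by a Lyapunov function\<close>

lemma trace_transpose_mult:
  fixes M :: "real^'w^'y"
  shows "trace (transpose M ** M) = (\<Sum>j\<in>UNIV. (norm (column j M))\<^sup>2)"
  by (simp add: trace_def matrix_mult_transpose_dot_column power2_norm_eq_inner)

text \<open>The integrand is the sum of \<open>(norm (C *v x j t))\<^sup>2\<close> over the
  trajectories \<open>x j\<close> started at the columns of \<open>B\<close>. By the first
  hypothesis \<open>- V\<close> summed over them is an antiderivative, and by the second it vanishes
  at infinity, so only the value at time 0 remains.\<close>

lemma H2_norm_sq_Lyapunov:
  fixes A :: "real^'s::finite^'s" and B :: "real^'w::finite^'s" and C :: "real^'s^'y::finite"
  assumes deriv: "\<And>x t. (\<And>t. (x has_vector_derivative A *v x t) (at t)) \<Longrightarrow>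
      ((\<lambda>t. V (x t)) has_real_derivative - (norm (C *v x t))\<^sup>2) (at t)"
    and lim: "\<And>x. (\<And>t. (x has_vector_derivative A *v x t) (at t)) \<Longrightarrow>
      ((\<lambda>t. V (x t)) \<longlongrightarrow> 0) at_top"
  shows "H2_norm_sq A B C = ennreal (\<Sum>j\<in>UNIV. V (column j B))"
proof -
  define x where "x j t = mat_exp (t *\<^sub>R A) *v column j B" for j t
  have x: "(x j has_vector_derivative A *v x j t) (at t)" for j t
    unfolding x_def by (rule has_vector_derivative_mat_exp)
  define f where "f t = (\<Sum>j\<in>UNIV. (norm (C *v x j t))\<^sup>2)" for t
  have "trace (transpose B ** mat_exp (t *\<^sub>R transpose A) ** transpose C ** C ** mat_exp (t *\<^sub>R A) ** B)
      = f t" for t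
  proof -
    have "transpose B ** mat_exp (t *\<^sub>R transpose A) ** transpose C ** C ** mat_exp (t *\<^sub>R A) ** B
        = transpose (C ** mat_exp (t *\<^sub>R A) ** B) ** (C ** mat_exp (t *\<^sub>R A) ** B)"
      by (simp only: matrix_transpose_mul mat_exp_transpose matrix_mul_assoc)
    moreover have "column j (C ** mat_exp (t *\<^sub>R A) ** B) = C *v x j t" for j
      unfolding x_def
      by (simp add: matrix_vector_mul_assoc matrix_mul_assoc flip: matrix_vector_mult_basis)
    ultimately show ?thesis
      by (simp add: trace_transpose_mult f_def)
  qed
  then have "H2_norm_sq A B C = (\<integral>\<^sup>+t. ennreal (f t) * indicator {0..} t \<partial>lborel)"
    by (simp add: H2_norm_sq_def)
  also have "\<dots> = ennreal (0 - - (\<Sum>j\<in>UNIV. V (x j 0)))"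
  proof (rule nn_integral_FTC_atLeast)
    have "continuous_on UNIV (x j)" for j
      by (intro continuous_at_imp_continuous_on ballI has_vector_derivative_continuous[OF x])
    then show "f \<in> borel_measurable borel"
      unfolding f_def
      by (intro borel_measurable_continuous_onI continuous_intros
          bounded_linear.continuous_on[OF matrix_vector_mul_bounded_linear])
    show "((\<lambda>t. - (\<Sum>j\<in>UNIV. V (x j t))) has_real_derivative f t) (at t)" for t
    proof -
      have "((\<lambda>t. \<Sum>j\<in>UNIV. V (x j t)) has_real_derivative
          (\<Sum>j\<in>UNIV. - (norm (C *v x j t))\<^sup>2)) (at t)"
        by (intro DERIV_sum deriv x)
      from DERIV_minus[OF this] show ?thesis
        by (simp add: f_def sum_negf)
    qed
    show "0 \<le> f t" for t
      by (simp add: f_def sum_nonneg)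
    show "((\<lambda>t. - (\<Sum>j\<in>UNIV. V (x j t))) \<longlongrightarrow> 0) at_top"
      using tendsto_minus[OF tendsto_sum[where f = "\<lambda>j t. V (x j t)" and I = UNIV, OF lim[OF x]]]
      by simp
  qed
  also have "\<dots> = ennreal (\<Sum>j\<in>UNIV. V (column j B))"
    using mat_exp_0[of A] by (simp add: x_def)
  finally show ?thesis .
qed

text \<open>Since \<open>E\<close> is nonincreasing, \<open>F t + c t E t\<close> is nonincreasing as well, so \<open>E\<close> decays like
  \<open>1/t\<close>.\<close>

lemma tendsto_zero_of_integrable_decreasing:
  fixes E F E' F' :: "real \<Rightarrow> real"
  assumes "\<And>t. (E has_real_derivative E' t) (at t)" and "\<And>t. E' t \<le> 0" and "\<And>t. 0 \<le> E t"
    and "\<And>t. (F has_real_derivative F' t) (at t)" and "\<And>t. F' t \<le> - (c * E t)"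
    and "\<And>t. 0 \<le> F t" and "0 < c"
  shows "(E \<longlongrightarrow> 0) at_top"
proof (rule tendsto_sandwich[where f = "\<lambda>_. 0" and h = "\<lambda>t. F 0 / c / t"])
  have "c * t * E t \<le> F 0" if "0 \<le> t" for t
  proof -
    have "F t + c * t * E t \<le> F 0 + c * 0 * E 0"
    proof (rule DERIV_nonpos_imp_nonincreasing[OF that])
      fix s assume "0 \<le> s" "s \<le> t"
      then have "F' s + (c * E s + c * s * E' s) \<le> 0"
        using assms(2,5)[of s] \<open>0 < c\<close> mult_nonneg_nonpos[of "c * s" "E' s"] by simp
      then show "\<exists>y. ((\<lambda>t. F t + c * t * E t) has_real_derivative y) (at s) \<and> y \<le> 0"
        by (intro exI[of _ "F' s + (c * E s + c * s * E' s)"] conjI)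
          (auto intro!: derivative_eq_intros assms(1,4))
    qed
    then show ?thesis using assms(6)[of t] by simp
  qed
  then have "E t * (c * t) \<le> F 0" if "0 < t" for t
    using that by (metis less_imp_le mult.commute)
  then have "E t \<le> F 0 / c / t" if "0 < t" for t
    using that \<open>0 < c\<close> by (simp add: pos_le_divide_eq)
  then show "\<forall>\<^sub>F t in at_top. E t \<le> F 0 / c / t"
    by (rule eventually_mono[OF eventually_gt_at_top[of 0]])
  show "((\<lambda>t. F 0 / c / t) \<longlongrightarrow> 0) at_top"
    by (intro tendsto_divide_0[OF tendsto_const] filterlim_at_top_imp_at_infinity filterlim_ident)
qed (use assms(3) in auto)

section \<open>The Laplacian as a quadratic form\<close>

text \<open>Extension of the weights by 0 to non-edges, so that sums over edges become sums over all
  pairs of vertices.\<close>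

definition edge_weight :: "'n set set \<Rightarrow> ('n set \<Rightarrow> real) \<Rightarrow> 'n \<Rightarrow> 'n \<Rightarrow> real" where
  "edge_weight E a i j = (if {i, j} \<in> E then a {i, j} else 0)"

lemma edge_weight_commute: "edge_weight E a i j = edge_weight E a j i"
  by (simp add: edge_weight_def insert_commute)

lemma edge_weight_nonneg: "weighted_graph E a \<Longrightarrow> 0 \<le> edge_weight E a i j"
  by (auto simp: edge_weight_def weighted_graph_def intro: less_imp_le)

lemma edge_weight_self: "weighted_graph E a \<Longrightarrow> edge_weight E a i i = 0"
  by (auto simp: edge_weight_def weighted_graph_def)

text \<open>The Laplacian is the degree matrix minus the weight matrix. Edges have two elements, so
  the weight matrix has zero diagonal and one formula covers diagonal and off-diagonal
  entries.\<close>

lemma laplacian_mult_nth: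
  assumes "weighted_graph E a"
  shows "(laplacian E a *v p) $ i = (\<Sum>j\<in>UNIV. edge_weight E a i j * (p $ i - p $ j))"
proof -
  let ?w = "edge_weight E a"
  have "(\<Sum>k | {i, k} \<in> E. a {i, k}) = (\<Sum>k\<in>UNIV. ?w i k)"
    by (simp add: edge_weight_def sum.If_cases)
  then have "laplacian E a $ i $ j = (if j = i then \<Sum>k\<in>UNIV. ?w i k else 0) - ?w i j" for j
    using edge_weight_self[OF assms, of i] by (auto simp: laplacian_def edge_weight_def)
  then have "(laplacian E a *v p) $ i
      = (\<Sum>j\<in>UNIV. (if j = i then (\<Sum>k\<in>UNIV. ?w i k) * p $ j else 0) - ?w i j * p $ j)"
    by (auto simp: matrix_vector_mult_def left_diff_distrib intro!: sum.cong)
  also have "\<dots> = (\<Sum>k\<in>UNIV. ?w i k) * p $ i - (\<Sum>j\<in>UNIV. ?w i j * p $ j)"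
    by (simp add: sum_subtractf)
  also have "\<dots> = (\<Sum>j\<in>UNIV. ?w i j * (p $ i - p $ j))"
    by (simp add: sum_distrib_right right_diff_distrib sum_subtractf)
  finally show ?thesis .
qed

lemma laplacian_mult_one: "weighted_graph E a \<Longrightarrow> laplacian E a *v 1 = 0"
  by (simp add: vec_eq_iff laplacian_mult_nth)

text \<open>Averaging the double sum with its copy under exchange of \<open>i\<close> and
  \<open>j\<close> symmetrizes it; symmetry and positive semidefiniteness can then be read
  off.\<close>

lemma laplacian_inner:
  assumes "weighted_graph E a"
  shows "q \<bullet> (laplacian E a *v p)
    = (\<Sum>i\<in>UNIV. \<Sum>j\<in>UNIV. edge_weight E a i j * (q $ i - q $ j) * (p $ i - p $ j)) / 2"
proof -
  let ?w = "edge_weight E a"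
  have eq: "q \<bullet> (laplacian E a *v p) = (\<Sum>i\<in>UNIV. \<Sum>j\<in>UNIV. ?w i j * q $ i * (p $ i - p $ j))"
    by (simp add: inner_vec_def laplacian_mult_nth[OF assms] sum_distrib_left mult_ac)
  also have "\<dots> = (\<Sum>i\<in>UNIV. \<Sum>j\<in>UNIV. ?w i j * q $ j * (p $ j - p $ i))"
    by (subst sum.swap) (simp add: edge_weight_commute[of E a])
  finally have eq': "q \<bullet> (laplacian E a *v p) = \<dots>" .
  have "2 * (q \<bullet> (laplacian E a *v p))
      = (\<Sum>i\<in>UNIV. \<Sum>j\<in>UNIV. ?w i j * q $ i * (p $ i - p $ j) + ?w i j * q $ j * (p $ j - p $ i))"
    using eq eq' by (simp add: sum.distrib)
  also have "\<dots> = (\<Sum>i\<in>UNIV. \<Sum>j\<in>UNIV. ?w i j * (q $ i - q $ j) * (p $ i - p $ j))"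
    by (simp add: algebra_simps)
  finally show ?thesis by simp
qed

lemma laplacian_symmetric:
  "weighted_graph E a \<Longrightarrow> q \<bullet> (laplacian E a *v p) = p \<bullet> (laplacian E a *v q)"
  by (simp add: laplacian_inner mult_ac)

lemma laplacian_nonneg:
  assumes "weighted_graph E a"
  shows "0 \<le> p \<bullet> (laplacian E a *v p)"
  by (simp add: laplacian_inner[OF assms] mult.assoc sum_nonneg edge_weight_nonneg[OF assms])

section \<open>Centred inner product\<close>

text \<open>Inner product of the deviations of \<open>p\<close> and \<open>q\<close> from their
  means, that is, of their projections orthogonal to \<open>1\<close>.\<close>

definition cinner :: "real^'n::finite \<Rightarrow> real^'n \<Rightarrow> real" where
  "cinner p q = p \<bullet> q - (1 \<bullet> p) * (1 \<bullet> q) / real CARD('n)"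

lemma inner_one_one: "(1 :: real^'n) \<bullet> 1 = real CARD('n::finite)"
  by (simp add: inner_vec_def)

lemma cinner_nonneg: "0 \<le> cinner p p"
  for p :: "real^'n::finite"
  using Cauchy_Schwarz_ineq[of 1 p]
  by (simp add: cinner_def inner_one_one power2_eq_square field_simps)

lemma DERIV_square: "(f has_real_derivative f') (at t) \<Longrightarrow>
    ((\<lambda>t. (f t)\<^sup>2) has_real_derivative 2 * f t * f') (at t)" for f :: "real \<Rightarrow> real"
  by (auto intro!: derivative_eq_intros)

lemma has_real_derivative_inner:
  fixes f g :: "real \<Rightarrow> 'b::real_inner"
  assumes "(f has_vector_derivative f') (at t)" "(g has_vector_derivative g') (at t)"
  shows "((\<lambda>t. f t \<bullet> g t) has_real_derivative f' \<bullet> g t + f t \<bullet> g') (at t)"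
  unfolding has_real_derivative_iff_has_vector_derivative
  using bounded_bilinear.has_vector_derivative[OF bounded_bilinear_inner assms]
  by (simp add: add.commute)

section \<open>Trajectories of the closed loop\<close>

text \<open>The graph enters only through three properties of \<open>L\<close>. The input is zero,
  since the columns of \<open>B\<close> act as initial states.\<close>

locale gbpiac_trajectory =
  fixes m d k1 :: real and L :: "real^'n::finite^'n" and x :: "real \<Rightarrow> 'n state"
  assumes pos: "0 < m" "0 < d" "0 < k1"
    and L_one: "L *v 1 = 0"
    and L_symmetric: "\<And>p q. q \<bullet> (L *v p) = p \<bullet> (L *v q)"
    and L_nonneg: "\<And>p. 0 \<le> p \<bullet> (L *v p)"
    and solution: "\<And>t. (x has_vector_derivative gbpiac_rhs m d k1 L (x t) 0) (at t)"
begin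

abbreviation "\<theta> t \<equiv> theta (x t)"
abbreviation "\<omega> t \<equiv> omega (x t)"
abbreviation "s t \<equiv> 1 \<bullet> omega (x t)"
abbreviation "\<zeta> t \<equiv> m * s t + x t $ Eta"
abbreviation "\<xi> t \<equiv> x t $ Xi"

section \<open>Equations of motion of the mean and of the deviations\<close>

lemma one_inner_L: "1 \<bullet> (L *v p) = 0"
  using L_symmetric[of 1 p] by (simp add: L_one)

lemma theta_deriv: "(\<theta> has_vector_derivative \<omega> t) (at t)"
  using bounded_linear.has_vector_derivative[OF linear_conv_bounded_linear[THEN iffD1, OF linear_theta] solution[of t]]
  by (simp add: gbpiac_rhs_def theta_def mk_state_def)

lemma omega_deriv:
  "(\<omega> has_vector_derivative (1 / m) *\<^sub>R (- (L *v \<theta> t) - d *\<^sub>R \<omega> t + control k1 (x t))) (at t)"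
proof -
  have "omega (gbpiac_rhs m d k1 L y 0) = (1 / m) *\<^sub>R (- (L *v theta y) - d *\<^sub>R omega y + control k1 y)" for y
    by (simp add: vec_eq_iff gbpiac_rhs_nth omega_def)
  then show ?thesis
    using bounded_linear.has_vector_derivative[OF linear_conv_bounded_linear[THEN iffD1, OF linear_omega] solution[of t]]
    by simp
qed

lemma state_deriv: "((\<lambda>t. x t $ i) has_real_derivative gbpiac_rhs m d k1 L (x t) 0 $ i) (at t)"
  unfolding has_real_derivative_iff_has_vector_derivative
  by (rule bounded_linear.has_vector_derivative[OF bounded_linear_vec_nth solution])

lemma control_inner: "q \<bullet> control k1 (x t) = 4 * k1 * \<xi> t / real CARD('n) * (1 \<bullet> q)"
  by (simp add: control_def inner_commute)

lemma s_deriv: "(s has_real_derivative (4 * k1 * \<xi> t - d * s t) / m) (at t)"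
  using has_real_derivative_inner[OF has_vector_derivative_const[of 1] omega_deriv[of t]]
  by (simp add: inner_add_right inner_diff_right one_inner_L control_inner inner_one_one)

lemma xi_deriv: "(\<xi> has_real_derivative - k1 * \<zeta> t - 4 * k1 * \<xi> t) (at t)"
  by (rule DERIV_cong[OF state_deriv]) (simp add: gbpiac_rhs_nth algebra_simps)

text \<open>The damping term \<open>- d * s t\<close> in \<open>m\<close> times the derivative of
  \<open>s\<close> cancels against the derivative of \<open>Eta\<close>.\<close>

lemma zeta_deriv: "(\<zeta> has_real_derivative 4 * k1 * \<xi> t) (at t)"
proof -
  have "((\<lambda>t. x t $ Eta) has_real_derivative d * s t) (at t)"
    using state_deriv[of Eta t] by (simp add: gbpiac_rhs_nth)
  from DERIV_add[OF DERIV_cmult[OF s_deriv, of m t] this] show ?thesis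
    using pos by simp
qed

text \<open>The control is a multiple of \<open>1\<close> and so drops out of the centred product;
  \<open>L *v \<theta> t\<close> is orthogonal to \<open>1\<close>, so the coupling stays a plain
  inner product.\<close>

lemma cinner_omega_omega_deriv:
  "((\<lambda>t. cinner (\<omega> t) (\<omega> t)) has_real_derivative
     - 2 / m * (\<omega> t \<bullet> (L *v \<theta> t) + d * cinner (\<omega> t) (\<omega> t))) (at t)"
  unfolding cinner_def
  by (rule DERIV_cong, rule DERIV_diff[OF has_real_derivative_inner[OF omega_deriv omega_deriv]
        DERIV_cdivide[OF DERIV_mult[OF s_deriv s_deriv]]])
    (use pos in \<open>simp add: inner_add_right inner_diff_right inner_add_left inner_diff_left
      inner_commute[of "L *v \<theta> t"] inner_commute[of "control k1 (x t)"] control_inner field_simps\<close>)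

lemma cinner_theta_omega_deriv:
  "((\<lambda>t. cinner (\<theta> t) (\<omega> t)) has_real_derivative
     cinner (\<omega> t) (\<omega> t) - (\<theta> t \<bullet> (L *v \<theta> t) + d * cinner (\<theta> t) (\<omega> t)) / m) (at t)"
proof -
  have r: "((\<lambda>t. 1 \<bullet> \<theta> t) has_real_derivative s t) (at t)"
    using has_real_derivative_inner[OF has_vector_derivative_const theta_deriv] by simp
  show ?thesis
    unfolding cinner_def
    by (rule DERIV_cong, rule DERIV_diff[OF has_real_derivative_inner[OF theta_deriv omega_deriv]
          DERIV_cdivide[OF DERIV_mult[OF r s_deriv]]])
      (use pos in \<open>simp add: inner_add_right inner_diff_right control_inner field_simps\<close>)
qed

lemma cinner_theta_theta_deriv:
  "((\<lambda>t. cinner (\<theta> t) (\<theta> t)) has_real_derivative 2 * cinner (\<theta> t) (\<omega> t)) (at t)"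
proof -
  have r: "((\<lambda>t. 1 \<bullet> \<theta> t) has_real_derivative s t) (at t)"
    using has_real_derivative_inner[OF has_vector_derivative_const theta_deriv] by simp
  show ?thesis
    unfolding cinner_def
    by (rule DERIV_cong, rule DERIV_diff[OF has_real_derivative_inner[OF theta_deriv theta_deriv]
          DERIV_cdivide[OF DERIV_mult[OF r r]]])
      (simp add: inner_commute[of "\<omega> t" "\<theta> t"] field_simps)
qed

lemma potential_deriv:
  "((\<lambda>t. \<theta> t \<bullet> (L *v \<theta> t)) has_real_derivative 2 * (\<omega> t \<bullet> (L *v \<theta> t))) (at t)"
  by (rule DERIV_cong[OF has_real_derivative_inner[OF theta_deriv
      bounded_linear.has_vector_derivative[OF matrix_vector_mul_bounded_linear theta_deriv]]])
    (use L_symmetric[of "\<theta> t" "\<omega> t"] in simp)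

section \<open>Decay of the energy of the deviations\<close>

definition "energy t = m / 2 * cinner (\<omega> t) (\<omega> t) + (\<theta> t \<bullet> (L *v \<theta> t)) / 2"

lemma energy_nonneg: "0 \<le> energy t"
  using pos by (simp add: energy_def cinner_nonneg L_nonneg)

lemma energy_deriv: "(energy has_real_derivative - d * cinner (\<omega> t) (\<omega> t)) (at t)"
  unfolding energy_def
  by (rule DERIV_cong, rule DERIV_add[OF DERIV_cmult[OF cinner_omega_omega_deriv]
        DERIV_cdivide[OF potential_deriv]])
    (use pos in \<open>simp add: field_simps\<close>)

text \<open>The cross term \<open>m cinner \<theta> \<omega>\<close> makes the potential energy appear in the dissipation, so
  that the time integral of the energy is finite even when the graph is disconnected.\<close>

lemma energy_tendsto_zero: "(energy \<longlongrightarrow> 0) at_top"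
proof (rule tendsto_zero_of_integrable_decreasing[where c = 2])
  \<comment> \<open>The term in \<open>cinner \<theta> \<theta>\<close> cancels the damping part of
    the derivative of the cross term; the multiple of \<open>energy\<close> turns its positive
    kinetic contribution \<open>m * cinner \<omega> \<omega>\<close> into the negative one.\<close>
  define F where "F t = m * cinner (\<theta> t) (\<omega> t) + d / 2 * cinner (\<theta> t) (\<theta> t) + 2 * m / d * energy t" for t
  show "(F has_real_derivative - 2 * energy t) (at t)" for t
    unfolding F_def
    by (rule DERIV_cong, rule DERIV_add[OF DERIV_add[OF DERIV_cmult[OF cinner_theta_omega_deriv]
          DERIV_cmult[OF cinner_theta_theta_deriv]] DERIV_cmult[OF energy_deriv]])
      (use pos in \<open>simp add: energy_def field_simps\<close>)
  show "0 \<le> F t" for t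
  proof -
    \<comment> \<open>Half of the kinetic part of the energy term completes the square with the
      cross term.\<close>
    have "F t = cinner (d *\<^sub>R \<theta> t + m *\<^sub>R \<omega> t) (d *\<^sub>R \<theta> t + m *\<^sub>R \<omega> t) / (2 * d)
        + m\<^sup>2 / (2 * d) * cinner (\<omega> t) (\<omega> t) + m / d * (\<theta> t \<bullet> (L *v \<theta> t))"
      using pos
      by (simp add: F_def energy_def cinner_def inner_add_left inner_add_right
          inner_commute[of "\<omega> t" "\<theta> t"] field_simps power2_eq_square)
    then show ?thesis
      using pos by (simp add: cinner_nonneg L_nonneg)
  qed
  show "- d * cinner (\<omega> t) (\<omega> t) \<le> 0" for t
    using pos by (simp add: cinner_nonneg)
qed (use energy_deriv energy_nonneg in auto)

text \<open>\<open>E\<close> is a positive definite form in \<open>s\<close>,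
  \<open>\<zeta>\<close>, \<open>\<xi>\<close> whose dissipation does not see
  \<open>\<zeta>\<close>; \<open>F\<close> adds a cross term \<open>\<zeta> \<xi>\<close> to make
  the time integral of \<open>E\<close> finite.\<close>

lemma mean_tendsto_zero: "(s \<longlongrightarrow> 0) at_top" "(\<zeta> \<longlongrightarrow> 0) at_top" "(\<xi> \<longlongrightarrow> 0) at_top"
proof -
  \<comment> \<open>This value makes the terms of \<open>E'\<close> in \<open>s \<xi>\<close> and
    \<open>\<xi>\<^sup>2\<close> complete a square, with a multiple of \<open>(s t)\<^sup>2\<close>
    left over.\<close>
  define c where "c = 2 * k1 / (m * d)"
  have c: "0 < c" using pos by (simp add: c_def)
  define E where "E t = (s t)\<^sup>2 + c * ((\<zeta> t)\<^sup>2 / 4 + (\<xi> t)\<^sup>2)" for t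
  define E' where "E' t = 2 * s t * ((4 * k1 * \<xi> t - d * s t) / m) - 8 * c * k1 * (\<xi> t)\<^sup>2" for t
  \<comment> \<open>The cross term yields \<open>- k1 * (\<zeta> t)\<^sup>2\<close>; the
    coefficients \<open>3 / 4\<close> and 1 remove the resulting products
    \<open>\<zeta> \<xi>\<close> and make the \<open>\<xi>\<^sup>2\<close> term negative.\<close>
  define F where "F t = m / d * E t + c / (4 * k1) * (\<zeta> t * \<xi> t + 3 / 4 * (\<zeta> t)\<^sup>2 + (\<xi> t)\<^sup>2)" for t
  have E': "(E has_real_derivative E' t) (at t)" for t
    unfolding E_def E'_def
    by (rule DERIV_cong, rule DERIV_add[OF DERIV_square[OF s_deriv] DERIV_cmult[OF DERIV_add[OF
          DERIV_cdivide[OF DERIV_square[OF zeta_deriv]] DERIV_square[OF xi_deriv]]]])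
      (simp add: algebra_simps power2_eq_square)
  have E'_eq: "E' t = - (d / m * (s t)\<^sup>2) - (d * s t - 4 * k1 * \<xi> t)\<^sup>2 / (m * d)" for t
    using pos by (simp add: E'_def c_def power2_eq_square field_simps)
  have E'_le: "E' t \<le> - (d / m * (s t)\<^sup>2)" for t
    using pos by (simp add: E'_eq)
  have F': "(F has_real_derivative m / d * E' t - c * ((\<zeta> t)\<^sup>2 / 4 + (\<xi> t)\<^sup>2)) (at t)" for t
    unfolding F_def
    by (rule DERIV_cong, rule DERIV_add[OF DERIV_cmult[OF E'] DERIV_cmult[OF DERIV_add[OF DERIV_add[OF
          DERIV_mult[OF zeta_deriv xi_deriv] DERIV_cmult[OF DERIV_square[OF zeta_deriv]]]
            DERIV_square[OF xi_deriv]]]])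
      (use pos in \<open>simp add: field_simps power2_eq_square\<close>)
  have lim: "(E \<longlongrightarrow> 0) at_top"
  proof (rule tendsto_zero_of_integrable_decreasing[OF E' _ _ F', where c = 1])
    show "E' t \<le> 0" for t
      using E'_le[of t] pos by (smt (verit) divide_pos_pos mult_nonneg_nonneg zero_le_power2)
    show E: "0 \<le> E t" for t
      using c by (simp add: E_def)
    show "m / d * E' t - c * ((\<zeta> t)\<^sup>2 / 4 + (\<xi> t)\<^sup>2) \<le> - (1 * E t)" for t
      using mult_left_mono[OF E'_le[of t], of "m / d"] pos by (simp add: E_def)
    show "0 \<le> F t" for t
    proof -
      have "\<zeta> t * \<xi> t + 3 / 4 * (\<zeta> t)\<^sup>2 + (\<xi> t)\<^sup>2 = (\<zeta> t / 2 + \<xi> t)\<^sup>2 + (\<zeta> t)\<^sup>2 / 2"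
        by (simp add: power2_eq_square algebra_simps)
      then show ?thesis
        using pos c E[of t] by (simp add: F_def)
    qed
  qed simp
  have 1: "((\<lambda>t. (s t)\<^sup>2) \<longlongrightarrow> 0) at_top"
    by (rule tendsto_sandwich[OF _ _ tendsto_const lim]) (use c in \<open>auto simp: E_def\<close>)
  have 2: "((\<lambda>t. c / 4 * (\<zeta> t)\<^sup>2) \<longlongrightarrow> 0) at_top"
    by (rule tendsto_sandwich[OF _ _ tendsto_const lim]) (use c in \<open>auto simp: E_def distrib_left\<close>)
  have 3: "((\<lambda>t. c * (\<xi> t)\<^sup>2) \<longlongrightarrow> 0) at_top"
    by (rule tendsto_sandwich[OF _ _ tendsto_const lim]) (use c in \<open>auto simp: E_def distrib_left\<close>)
  show "(s \<longlongrightarrow> 0) at_top" "(\<zeta> \<longlongrightarrow> 0) at_top" "(\<xi> \<longlongrightarrow> 0) at_top"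
    using 1 tendsto_mult_left[OF 2, of "4 / c"] tendsto_mult_left[OF 3, of "1 / c"] c
    by simp_all
qed

end

section \<open>Lyapunov functions for the two outputs\<close>

text \<open>With the weight \<open>1 / 4\<close> the products \<open>\<zeta> \<xi>\<close> cancel in
  the derivative of the bracket, which is \<open>- 8 * k1 * \<xi>\<^sup>2\<close>; the prefactor
  scales this to the squared norm of the control.\<close>

definition V_u :: "real \<Rightarrow> real \<Rightarrow> 'n::finite state \<Rightarrow> real" where
  "V_u m k1 y = 2 * k1 / real CARD('n) * ((m * (1 \<bullet> omega y) + y $ Eta)\<^sup>2 / 4 + (y $ Xi)\<^sup>2)"

text \<open>Quadratic form whose derivative along the three-dimensional subsystem for
  \<open>s = 1 \<bullet> \<omega>\<close>, \<open>\<zeta> = m s + \<eta>\<close> and \<open>\<xi>\<close> is \<open>- s\<^sup>2\<close>; the coefficients solve the corresponding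
  Lyapunov equation.\<close>

definition V_mean :: "real \<Rightarrow> real \<Rightarrow> real \<Rightarrow> real \<Rightarrow> real \<Rightarrow> real \<Rightarrow> real" where
  "V_mean m d k1 s \<zeta> \<xi> = m / (2 * d) * s\<^sup>2
     + (- 4 * k1\<^sup>2 * m\<^sup>2 / d * s * \<zeta> + 4 * k1 * m * s * \<xi> + 2 * k1 * \<xi>\<^sup>2
        + k1 * (d + 4 * k1 * m) / (2 * d) * \<zeta>\<^sup>2) / (d + 2 * k1 * m)\<^sup>2"

text \<open>The squared norm of \<open>\<omega>\<close> is \<open>cinner \<omega> \<omega>\<close>
  plus \<open>s\<^sup>2\<close> over the number of nodes; the first summand of
  \<open>V_omega\<close> dissipates the former, the second the latter.\<close>

definition V_omega :: "real \<Rightarrow> real \<Rightarrow> real \<Rightarrow> real^'n::finite^'n \<Rightarrow> 'n state \<Rightarrow> real" where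
  "V_omega m d k1 L y = (m * cinner (omega y) (omega y) + theta y \<bullet> (L *v theta y)) / (2 * d)
     + V_mean m d k1 (1 \<bullet> omega y) (m * (1 \<bullet> omega y) + y $ Eta) (y $ Xi) / real CARD('n)"

lemma DERIV_V_mean:
  assumes "(s has_real_derivative s') (at t)" and "(\<zeta> has_real_derivative \<zeta>') (at t)"
    and "(\<xi> has_real_derivative \<xi>') (at t)"
  shows "((\<lambda>t. V_mean m d k1 (s t) (\<zeta> t) (\<xi> t)) has_real_derivative
      m / d * s t * s' + (- 4 * k1\<^sup>2 * m\<^sup>2 / d * (s' * \<zeta> t + s t * \<zeta>')
        + 4 * k1 * m * (s' * \<xi> t + s t * \<xi>') + 4 * k1 * \<xi> t * \<xi>'
        + k1 * (d + 4 * k1 * m) / d * \<zeta> t * \<zeta>') / (d + 2 * k1 * m)\<^sup>2) (at t)"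
  unfolding V_mean_def
  by (rule DERIV_cong, rule DERIV_add[OF DERIV_cmult[OF DERIV_square[OF assms(1)]]
        DERIV_cdivide[OF DERIV_add[OF DERIV_add[OF DERIV_add[OF
          DERIV_mult[OF DERIV_cmult[OF assms(1)] assms(2)]
          DERIV_mult[OF DERIV_cmult[OF assms(1)] assms(3)]]
          DERIV_cmult[OF DERIV_square[OF assms(3)]]]
          DERIV_cmult[OF DERIV_square[OF assms(2)]]]]])
    (simp add: algebra_simps add_divide_distrib)

lemma tendsto_V_mean:
  assumes "(s \<longlongrightarrow> 0) F" and "(\<zeta> \<longlongrightarrow> 0) F" and "(\<xi> \<longlongrightarrow> 0) F"
  shows "((\<lambda>t. V_mean m d k1 (s t) (\<zeta> t) (\<xi> t)) \<longlongrightarrow> 0) F"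
proof -
  have "((\<lambda>t. V_mean m d k1 (s t) (\<zeta> t) (\<xi> t)) \<longlongrightarrow> V_mean m d k1 0 0 0) F"
    unfolding V_mean_def divide_inverse by (intro tendsto_intros assms)
  then show ?thesis by (simp add: V_mean_def)
qed

section \<open>Derivatives and limits along trajectories\<close>

context gbpiac_trajectory
begin

lemma V_mean_deriv:
  "((\<lambda>t. V_mean m d k1 (s t) (\<zeta> t) (\<xi> t)) has_real_derivative - (s t)\<^sup>2) (at t)"
proof (rule DERIV_cong[OF DERIV_V_mean[OF s_deriv zeta_deriv xi_deriv]])
  \<comment> \<open>\<open>a / m\<close> adds the decay rate \<open>d / m\<close> of
    \<open>s\<close> to the double rate \<open>2 * k1\<close> of \<open>(\<zeta>, \<xi>)\<close>,
    whence the denominator \<open>a\<^sup>2\<close>. It stays folded while denominators are cleared,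
    and \<open>z\<close> hides that \<open>\<zeta>\<close> contains \<open>s\<close>, since the
    identity holds for independent variables.\<close>
  define a where "a = d + 2 * k1 * m"
  have a: "a \<noteq> 0" using pos by (simp add: a_def add_pos_pos less_imp_neq[symmetric])
  define z where "z = \<zeta> t"
  show "m / d * s t * ((4 * k1 * \<xi> t - d * s t) / m)
      + (- 4 * k1\<^sup>2 * m\<^sup>2 / d * ((4 * k1 * \<xi> t - d * s t) / m * \<zeta> t + s t * (4 * k1 * \<xi> t))
        + 4 * k1 * m * ((4 * k1 * \<xi> t - d * s t) / m * \<xi> t + s t * (- k1 * \<zeta> t - 4 * k1 * \<xi> t))
        + 4 * k1 * \<xi> t * (- k1 * \<zeta> t - 4 * k1 * \<xi> t)
        + k1 * (d + 4 * k1 * m) / d * \<zeta> t * (4 * k1 * \<xi> t)) / (d + 2 * k1 * m)\<^sup>2 = - (s t)\<^sup>2"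
    unfolding z_def[symmetric] a_def[symmetric]
    using pos a
    by (simp add: divide_simps) (simp add: a_def power2_eq_square algebra_simps)
qed

lemma V_omega_eq:
  "V_omega m d k1 L (x t) = energy t / d + V_mean m d k1 (s t) (\<zeta> t) (\<xi> t) / real CARD('n)"
  using pos by (simp add: V_omega_def energy_def field_simps)

lemma V_omega_deriv:
  "((\<lambda>t. V_omega m d k1 L (x t)) has_real_derivative - (norm (\<omega> t))\<^sup>2) (at t)"
  unfolding V_omega_eq power2_norm_eq_inner
  by (rule DERIV_cong, rule DERIV_add[OF DERIV_cdivide[OF energy_deriv] DERIV_cdivide[OF V_mean_deriv]])
    (use pos in \<open>simp add: cinner_def power2_eq_square\<close>)

lemma V_omega_tendsto_zero: "((\<lambda>t. V_omega m d k1 L (x t)) \<longlongrightarrow> 0) at_top"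
  unfolding V_omega_eq
  by (intro tendsto_add_zero tendsto_divide_zero energy_tendsto_zero
      tendsto_V_mean mean_tendsto_zero)

lemma V_u_deriv:
  "((\<lambda>t. V_u m k1 (x t)) has_real_derivative - (norm (control k1 (x t)))\<^sup>2) (at t)"
  unfolding V_u_def power2_norm_eq_inner
  by (rule DERIV_cong, rule DERIV_cmult[OF DERIV_add[OF
        DERIV_cdivide[OF DERIV_square[OF zeta_deriv]] DERIV_square[OF xi_deriv]]])
    (simp add: control_def inner_one_one power2_eq_square field_simps)

lemma V_u_tendsto_zero: "((\<lambda>t. V_u m k1 (x t)) \<longlongrightarrow> 0) at_top"
  unfolding V_u_def power2_eq_square
  by (intro tendsto_mult_right_zero tendsto_add_zero tendsto_divide_zero tendsto_mult_zero
      mean_tendsto_zero)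

end

section \<open>Values of the Lyapunov functions at the columns of the input matrix\<close>

lemma column_gbpiac_B:
  "column j (gbpiac_B m d k1 L) = mk_state 0 ((1 / m) *\<^sub>R axis j 1) 0 0"
  using gbpiac_rhs_eq[of m d k1 L 0 "axis j 1"]
  by (simp add: matrix_vector_mult_basis gbpiac_rhs_def theta_def omega_def control_def
      flip: zero_vec_def)

lemma omega_column_gbpiac_B: "omega (column j (gbpiac_B m d k1 L)) = (1 / m) *\<^sub>R axis j 1"
  by (simp add: column_gbpiac_B omega_def mk_state_def vec_eq_iff)

lemma theta_column_gbpiac_B: "theta (column j (gbpiac_B m d k1 L)) = 0"
  by (simp add: column_gbpiac_B theta_def mk_state_def vec_eq_iff)

lemma V_u_gbpiac_B:
  fixes L :: "real^'n::finite^'n"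
  assumes "0 < m"
  shows "V_u m k1 (column j (gbpiac_B m d k1 L)) = k1 / (2 * real CARD('n))"
  using assms
  by (simp add: V_u_def omega_column_gbpiac_B inner_axis) (simp add: column_gbpiac_B mk_state_def)

lemma V_omega_gbpiac_B:
  fixes L :: "real^'n::finite^'n"
  assumes "0 < m" "0 < d" "0 < k1"
  shows "V_omega m d k1 L (column j (gbpiac_B m d k1 L))
    = ((real CARD('n) - 1) / (2 * m * d) + (d + 5 * m * k1) / (2 * m * (2 * k1 * m + d)\<^sup>2)) / real CARD('n)"
proof -
  let ?y = "column j (gbpiac_B m d k1 L)"
  define a where "a = d + 2 * k1 * m"
  have a: "a \<noteq> 0" using assms by (simp add: a_def add_pos_pos less_imp_neq[symmetric])
  have one: "1 \<bullet> omega ?y = 1 / m"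
    by (simp add: omega_column_gbpiac_B inner_axis)
  have "cinner (omega ?y) (omega ?y) = (1 - 1 / real CARD('n)) / m\<^sup>2"
    unfolding cinner_def one
    by (simp add: omega_column_gbpiac_B inner_axis power2_eq_square diff_divide_distrib)
  \<comment> \<open>A unit impulse at one node starts the mean subsystem at
    \<open>s = 1 / m\<close>, \<open>\<zeta> = m * s = 1\<close>, \<open>\<xi> = 0\<close>.\<close>
  moreover have "V_mean m d k1 (1 / m) 1 0 = (d + 5 * m * k1) / (2 * m * a\<^sup>2)"
    unfolding V_mean_def a_def[symmetric] using assms a
    by (simp add: divide_simps) (simp add: a_def power2_eq_square algebra_simps)
  moreover have "?y $ Eta = 0" "?y $ Xi = 0"
    by (simp_all add: column_gbpiac_B mk_state_def)
  moreover have "(m * ((1 - 1 / real CARD('n)) / m\<^sup>2)) / (2 * d)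
      = (real CARD('n) - 1) / (2 * m * d) / real CARD('n)"
    using assms by (simp add: field_simps power2_eq_square)
  ultimately show ?thesis
    using assms
    by (simp add: V_omega_def one theta_column_gbpiac_B add_divide_distrib a_def add.commute)
qed

theorem theorem4p2:
  fixes m d k1 :: real
    and E :: "'n::finite set set" and a :: "'n set \<Rightarrow> real"
    and L :: "real^'n^'n"
  assumes "m > 0" and "d > 0" and "k1 > 0"
    and "weighted_graph E a" and "L = laplacian E a"
  shows "H2_norm_sq (gbpiac_A m d k1 L) (gbpiac_B m d k1 L) C_omega
           = ennreal ((real CARD('n) - 1) / (2 * m * d)
               + (d + 5 * m * k1) / (2 * m * (2 * k1 * m + d)\<^sup>2))
       \<and> H2_norm_sq (gbpiac_A m d k1 L) (gbpiac_B m d k1 L) (C_u k1)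
           = ennreal (k1 / 2)"
proof
  have traj: "gbpiac_trajectory m d k1 L x"
    if "\<And>t. (x has_vector_derivative gbpiac_A m d k1 L *v x t) (at t)" for x
    using assms that
    by unfold_locales
      (simp_all add: laplacian_mult_one laplacian_symmetric laplacian_nonneg gbpiac_rhs_eq)
  have "H2_norm_sq (gbpiac_A m d k1 L) (gbpiac_B m d k1 L) C_omega
      = ennreal (\<Sum>j\<in>UNIV. V_omega m d k1 L (column j (gbpiac_B m d k1 L)))"
    by (rule H2_norm_sq_Lyapunov)
      (simp_all add: C_omega_works traj gbpiac_trajectory.V_omega_deriv
        gbpiac_trajectory.V_omega_tendsto_zero)
  also have "(\<Sum>j\<in>UNIV. V_omega m d k1 L (column j (gbpiac_B m d k1 L)))
      = (real CARD('n) - 1) / (2 * m * d) + (d + 5 * m * k1) / (2 * m * (2 * k1 * m + d)\<^sup>2)"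
    \<comment> \<open>All columns contribute equally, so summing cancels the division by the number
      of nodes.\<close>
    by (simp add: V_omega_gbpiac_B[OF assms(1-3)])
  finally show "H2_norm_sq (gbpiac_A m d k1 L) (gbpiac_B m d k1 L) C_omega = \<dots>" .
  have "H2_norm_sq (gbpiac_A m d k1 L) (gbpiac_B m d k1 L) (C_u k1)
      = ennreal (\<Sum>j\<in>UNIV. V_u m k1 (column j (gbpiac_B m d k1 L)))"
    by (rule H2_norm_sq_Lyapunov)
      (auto simp: C_u_works intro: gbpiac_trajectory.V_u_deriv gbpiac_trajectory.V_u_tendsto_zero
        traj)
  also have "(\<Sum>j\<in>UNIV. V_u m k1 (column j (gbpiac_B m d k1 L))) = k1 / 2"
    by (simp add: V_u_gbpiac_B[OF assms(1)])
  finally show "H2_norm_sq (gbpiac_A m d k1 L) (gbpiac_B m d k1 L) (C_u k1) = ennreal (k1 / 2)" .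
qed

end
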